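(* The functors $$D:\mathbf{CHaus}^{\mathrm{op}}\to\mathbf{T1Frm}_n\quad\text{and}\quad Max:\mathbf{T1Frm}_n\to\mathbf{CHaus}^{\mathrm{op}}$$ (defined in the context) define a duality between the category $\mathbf{CHaus}$ of compact Hausdorff spaces and continuous maps between them and the category $\mathbf{T1Frm}_n$ of conjunctive (equivalently, co-atomistic) compact normal frames and frame homomorphisms between them.
   Context: A distributive lattice (always bounded) $F$ is conjunctive if for all $a,b\in F$: if every $c\in F$ with $a\vee c=1$ satisfies $b\vee c=1$, then $a\le b$. It is normal if for all $a,b$ with $a\vee b=1$ there are $c,d$ with $c\vee a=b\vee d=1$ and $c\wedge d=0$. A frame is compact if every family of elements with join $1$ has a finite subfamily with join $1$. A co-atom of a frame is a maximal element among the elements different from $1$; a frame is co-atomistic if every element is the meet of the co-atoms greater than or equal to it. For a frame $F$, $Max(F)$ is the space of maximal (lattice) ideals of $F$ with basic open sets $\{M\in Max(F)\mid a\notin M\}$, $a\in F$. The functor $D$ sends a compact Hausdorff space $X$ to its frame $\mathcal O(X)$ of open sets and a continuous map $f:X\to Y$ to $f^{-1}:\mathcal O(Y)\to\mathcal O(X)$. The functor $Max$ sends $F$ to $Max(F)$ and a frame homomorphism $f:F\to F'$ to the map $Max(F')\to Max(F)$, $M\mapsto f^{-1}(M)$ (for frames in $\mathbf{T1Frm}_n$, every frame homomorphism pulls back maximal ideals to maximal ideals). *)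

theory Defs
  imports "HOL-Analysis.Analysis" "HOL-Algebra.Complete_Lattice"
begin

section \<open>Categories and functors\<close>

text \<open>Morphisms do not carry their domain and codomain, so composition and the action of a functor
  on morphisms take the objects involved as arguments: \<open>cat_comp C x y z g f\<close> is
  \<open>g\<close> after \<open>f\<close> for \<open>f : x \<rightarrow> y\<close> and \<open>g : y \<rightarrow> z\<close>, and \<open>fun_map T x y f\<close> is
  the image of \<open>f : x \<rightarrow> y\<close>.\<close>

record ('o, 'm) category =
  cat_ob :: "'o set"
  cat_hom :: "'o \<Rightarrow> 'o \<Rightarrow> 'm set"
  cat_id :: "'o \<Rightarrow> 'm"
  cat_comp :: "'o \<Rightarrow> 'o \<Rightarrow> 'o \<Rightarrow> 'm \<Rightarrow> 'm \<Rightarrow> 'm"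

definition is_category :: "('o, 'm) category \<Rightarrow> bool" where
  "is_category C \<longleftrightarrow>
     (\<forall>x\<in>cat_ob C. cat_id C x \<in> cat_hom C x x) \<and>
     (\<forall>x\<in>cat_ob C. \<forall>y\<in>cat_ob C. \<forall>z\<in>cat_ob C. \<forall>f\<in>cat_hom C x y. \<forall>g\<in>cat_hom C y z.
        cat_comp C x y z g f \<in> cat_hom C x z) \<and>
     (\<forall>x\<in>cat_ob C. \<forall>y\<in>cat_ob C. \<forall>f\<in>cat_hom C x y.
        cat_comp C x x y f (cat_id C x) = f \<and> cat_comp C x y y (cat_id C y) f = f) \<and>
     (\<forall>w\<in>cat_ob C. \<forall>x\<in>cat_ob C. \<forall>y\<in>cat_ob C. \<forall>z\<in>cat_ob C.
        \<forall>f\<in>cat_hom C w x. \<forall>g\<in>cat_hom C x y. \<forall>h\<in>cat_hom C y z.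
        cat_comp C w x z (cat_comp C x y z h g) f = cat_comp C w y z h (cat_comp C w x y g f))"

definition op_cat :: "('o, 'm) category \<Rightarrow> ('o, 'm) category" where
  "op_cat C = \<lparr> cat_ob = cat_ob C,
                cat_hom = (\<lambda>x y. cat_hom C y x),
                cat_id = cat_id C,
                cat_comp = (\<lambda>x y z g f. cat_comp C z y x f g) \<rparr>"

record ('o, 'm, 'p, 'n) functor_data =
  fun_ob :: "'o \<Rightarrow> 'p"
  fun_map :: "'o \<Rightarrow> 'o \<Rightarrow> 'm \<Rightarrow> 'n"

definition is_functor ::
  "('o, 'm) category \<Rightarrow> ('p, 'n) category \<Rightarrow> ('o, 'm, 'p, 'n) functor_data \<Rightarrow> bool" where
  "is_functor C E T \<longleftrightarrow>
     (\<forall>x\<in>cat_ob C. fun_ob T x \<in> cat_ob E) \<and>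
     (\<forall>x\<in>cat_ob C. \<forall>y\<in>cat_ob C. \<forall>f\<in>cat_hom C x y.
        fun_map T x y f \<in> cat_hom E (fun_ob T x) (fun_ob T y)) \<and>
     (\<forall>x\<in>cat_ob C. fun_map T x x (cat_id C x) = cat_id E (fun_ob T x)) \<and>
     (\<forall>x\<in>cat_ob C. \<forall>y\<in>cat_ob C. \<forall>z\<in>cat_ob C. \<forall>f\<in>cat_hom C x y. \<forall>g\<in>cat_hom C y z.
        fun_map T x z (cat_comp C x y z g f) =
        cat_comp E (fun_ob T x) (fun_ob T y) (fun_ob T z) (fun_map T y z g) (fun_map T x y f))"

definition fun_comp ::
  "('p, 'n, 'q, 'k) functor_data \<Rightarrow> ('o, 'm, 'p, 'n) functor_data \<Rightarrow> ('o, 'm, 'q, 'k) functor_data" where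
  "fun_comp S T = \<lparr> fun_ob = (\<lambda>x. fun_ob S (fun_ob T x)),
                    fun_map = (\<lambda>x y f. fun_map S (fun_ob T x) (fun_ob T y) (fun_map T x y f)) \<rparr>"

text \<open>A functor from \<open>C\<close> to \<open>E\<close>, regarded as a functor from \<open>op_cat C\<close> to \<open>op_cat E\<close>.\<close>

definition op_fun :: "('o, 'm, 'p, 'n) functor_data \<Rightarrow> ('o, 'm, 'p, 'n) functor_data" where
  "op_fun T = \<lparr> fun_ob = fun_ob T, fun_map = (\<lambda>x y. fun_map T y x) \<rparr>"


section \<open>Frames\<close>

definition frame :: "'b gorder \<Rightarrow> bool" where
  "frame F \<longleftrightarrow> complete_lattice F \<and>
     (\<forall>a\<in>carrier F. \<forall>S. S \<subseteq> carrier F \<longrightarrow>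
        a \<sqinter>\<^bsub>F\<^esub> (\<Squnion>\<^bsub>F\<^esub> S) = \<Squnion>\<^bsub>F\<^esub> ((\<lambda>s. a \<sqinter>\<^bsub>F\<^esub> s) ` S))"

definition frame_hom :: "'b gorder \<Rightarrow> 'c gorder \<Rightarrow> ('b \<Rightarrow> 'c) \<Rightarrow> bool" where
  "frame_hom F G h \<longleftrightarrow> h \<in> carrier F \<rightarrow> carrier G \<and>
     (\<forall>S. S \<subseteq> carrier F \<longrightarrow> h (\<Squnion>\<^bsub>F\<^esub> S) = \<Squnion>\<^bsub>G\<^esub> (h ` S)) \<and>
     (\<forall>a\<in>carrier F. \<forall>b\<in>carrier F. h (a \<sqinter>\<^bsub>F\<^esub> b) = h a \<sqinter>\<^bsub>G\<^esub> h b) \<and>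
     h \<top>\<^bsub>F\<^esub> = \<top>\<^bsub>G\<^esub>"

definition frame_isos :: "'b gorder \<Rightarrow> 'c gorder \<Rightarrow> ('b \<Rightarrow> 'c) \<Rightarrow> ('c \<Rightarrow> 'b) \<Rightarrow> bool" where
  "frame_isos F G h k \<longleftrightarrow> frame_hom F G h \<and> frame_hom G F k \<and>
     (\<forall>a\<in>carrier F. k (h a) = a) \<and> (\<forall>b\<in>carrier G. h (k b) = b)"

definition conjunctive :: "'b gorder \<Rightarrow> bool" where
  "conjunctive F \<longleftrightarrow> (\<forall>a\<in>carrier F. \<forall>b\<in>carrier F.
     (\<forall>c\<in>carrier F. a \<squnion>\<^bsub>F\<^esub> c = \<top>\<^bsub>F\<^esub> \<longrightarrow> b \<squnion>\<^bsub>F\<^esub> c = \<top>\<^bsub>F\<^esub>) \<longrightarrow> a \<sqsubseteq>\<^bsub>F\<^esub> b)"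

definition normal_lattice :: "'b gorder \<Rightarrow> bool" where
  "normal_lattice F \<longleftrightarrow> (\<forall>a\<in>carrier F. \<forall>b\<in>carrier F. a \<squnion>\<^bsub>F\<^esub> b = \<top>\<^bsub>F\<^esub> \<longrightarrow>
     (\<exists>c\<in>carrier F. \<exists>d\<in>carrier F.
        c \<squnion>\<^bsub>F\<^esub> a = \<top>\<^bsub>F\<^esub> \<and> b \<squnion>\<^bsub>F\<^esub> d = \<top>\<^bsub>F\<^esub> \<and> c \<sqinter>\<^bsub>F\<^esub> d = \<bottom>\<^bsub>F\<^esub>))"

definition compact_frame :: "'b gorder \<Rightarrow> bool" where
  "compact_frame F \<longleftrightarrow> frame F \<and>
     (\<forall>S. S \<subseteq> carrier F \<and> \<Squnion>\<^bsub>F\<^esub> S = \<top>\<^bsub>F\<^esub> \<longrightarrow>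
        (\<exists>S'. S' \<subseteq> S \<and> finite S' \<and> \<Squnion>\<^bsub>F\<^esub> S' = \<top>\<^bsub>F\<^esub>))"

definition coatom :: "'b gorder \<Rightarrow> 'b \<Rightarrow> bool" where
  "coatom F m \<longleftrightarrow> m \<in> carrier F \<and> m \<noteq> \<top>\<^bsub>F\<^esub> \<and>
     (\<forall>x\<in>carrier F. x \<noteq> \<top>\<^bsub>F\<^esub> \<and> m \<sqsubseteq>\<^bsub>F\<^esub> x \<longrightarrow> x = m)"

definition coatomistic :: "'b gorder \<Rightarrow> bool" where
  "coatomistic F \<longleftrightarrow> (\<forall>a\<in>carrier F. a = \<Sqinter>\<^bsub>F\<^esub> {m. coatom F m \<and> a \<sqsubseteq>\<^bsub>F\<^esub> m})"


section \<open>Maximal ideals\<close>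

definition lattice_ideal :: "'b gorder \<Rightarrow> 'b set \<Rightarrow> bool" where
  "lattice_ideal F I \<longleftrightarrow> I \<subseteq> carrier F \<and> \<bottom>\<^bsub>F\<^esub> \<in> I \<and>
     (\<forall>a\<in>I. \<forall>b\<in>I. a \<squnion>\<^bsub>F\<^esub> b \<in> I) \<and>
     (\<forall>a\<in>I. \<forall>b\<in>carrier F. b \<sqsubseteq>\<^bsub>F\<^esub> a \<longrightarrow> b \<in> I)"

definition maximal_ideals :: "'b gorder \<Rightarrow> 'b set set" where
  "maximal_ideals F = {M. lattice_ideal F M \<and> M \<noteq> carrier F \<and>
     (\<forall>I. lattice_ideal F I \<and> I \<noteq> carrier F \<and> M \<subseteq> I \<longrightarrow> I = M)}"

text \<open>For a frame, the generating sets below are closed under binary intersection, since maximal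
  ideals of a distributive lattice are prime; so they are a base of the generated topology.
  They cover \<open>maximal_ideals F\<close> (take \<open>a = \<top>\<close>), which is therefore the underlying set.\<close>

definition Max_space :: "'b gorder \<Rightarrow> 'b set topology" where
  "Max_space F = topology_generated_by {{M \<in> maximal_ideals F. a \<notin> M} | a. a \<in> carrier F}"

definition open_frame :: "'a topology \<Rightarrow> 'a set gorder" where
  "open_frame X = \<lparr> carrier = {U. openin X U}, eq = (=), le = (\<subseteq>) \<rparr>"


section \<open>The two categories and the two functors\<close>

text \<open>Each category lives over an arbitrary type, which plays the role of the universe from which
  the points of the spaces (the elements of the frames) are taken; the underlying set may be any
  subset of it. Morphisms are required to be \<open>extensional\<close> so that equality of morphisms is
  equality of maps on the underlying sets.\<close>

definition CHaus :: "('a topology, 'a \<Rightarrow> 'a) category" where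
  "CHaus = \<lparr> cat_ob = {X. compact_space X \<and> Hausdorff_space X},
             cat_hom = (\<lambda>X Y. {f \<in> extensional (topspace X). continuous_map X Y f}),
             cat_id = (\<lambda>X. \<lambda>x\<in>topspace X. x),
             cat_comp = (\<lambda>X Y Z g f. compose (topspace X) g f) \<rparr>"

definition T1Frm_n :: "('b gorder, 'b \<Rightarrow> 'b) category" where
  "T1Frm_n = \<lparr> cat_ob = {F. compact_frame F \<and> conjunctive F \<and> normal_lattice F},
               cat_hom = (\<lambda>F G. {h \<in> extensional (carrier F). frame_hom F G h}),
               cat_id = (\<lambda>F. \<lambda>a\<in>carrier F. a),
               cat_comp = (\<lambda>F G H k h. compose (carrier F) k h) \<rparr>"

text \<open>\<open>D_functor\<close> is a functor on \<open>op_cat CHaus\<close>: a morphism from \<open>X\<close> to \<open>Y\<close> there is a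
  continuous map \<open>f : Y \<rightarrow> X\<close>.\<close>

definition D_functor :: "('a topology, 'a \<Rightarrow> 'a, 'a set gorder, 'a set \<Rightarrow> 'a set) functor_data" where
  "D_functor = \<lparr> fun_ob = open_frame,
     fun_map = (\<lambda>X Y f. \<lambda>U\<in>carrier (open_frame X). {y \<in> topspace Y. f y \<in> U}) \<rparr>"

definition Max_functor :: "('b gorder, 'b \<Rightarrow> 'b, 'b set topology, 'b set \<Rightarrow> 'b set) functor_data" where
  "Max_functor = \<lparr> fun_ob = Max_space,
     fun_map = (\<lambda>F G h. \<lambda>M\<in>topspace (Max_space G). {a \<in> carrier F. h a \<in> M}) \<rparr>"


section \<open>Natural isomorphisms with the identity functor\<close>

text \<open>The round trips \<open>Max \<circ> D\<close> and \<open>D \<circ> Max\<close> raise the underlying type from \<open>'a\<close> to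
  \<open>'a set set\<close>. So the components of a natural isomorphism between the identity and a round trip
  \<open>T\<close> are isomorphisms between an object over one type and an object over another, and
  \<open>fun_map T X Y f \<circ> \<eta> X = \<eta> Y \<circ> f\<close> is an equation between maps from the one type to the other.\<close>

definition CHaus_id_iso :: "('a topology, 'a \<Rightarrow> 'a, 'c topology, 'c \<Rightarrow> 'c) functor_data \<Rightarrow> bool" where
  "CHaus_id_iso T \<longleftrightarrow> (\<exists>\<eta> :: 'a topology \<Rightarrow> 'a \<Rightarrow> 'c.
     (\<forall>X\<in>cat_ob CHaus. \<exists>\<zeta>. homeomorphic_maps X (fun_ob T X) (\<eta> X) \<zeta>) \<and>
     (\<forall>X\<in>cat_ob CHaus. \<forall>Y\<in>cat_ob CHaus. \<forall>f\<in>cat_hom CHaus X Y. \<forall>x\<in>topspace X.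
        fun_map T X Y f (\<eta> X x) = \<eta> Y (f x)))"

definition T1Frm_n_id_iso :: "('b gorder, 'b \<Rightarrow> 'b, 'c gorder, 'c \<Rightarrow> 'c) functor_data \<Rightarrow> bool" where
  "T1Frm_n_id_iso T \<longleftrightarrow> (\<exists>\<epsilon> :: 'b gorder \<Rightarrow> 'b \<Rightarrow> 'c.
     (\<forall>F\<in>cat_ob T1Frm_n. \<exists>\<delta>. frame_isos F (fun_ob T F) (\<epsilon> F) \<delta>) \<and>
     (\<forall>F\<in>cat_ob T1Frm_n. \<forall>G\<in>cat_ob T1Frm_n. \<forall>h\<in>cat_hom T1Frm_n F G. \<forall>a\<in>carrier F.
        fun_map T F G h (\<epsilon> F a) = \<epsilon> G (h a)))"

end

(* In a compact frame the join of a proper ideal is different from 1, so the maximal ideals are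
   exactly the principal ideals of co-atoms, and Max(F) is the set of co-atoms. Co-atoms are prime,
   so a |-> {M. a notin M} is a frame homomorphism onto the opens of Max(F); it is injective
   iff F is co-atomistic, which for compact F means conjunctive. In the frame of opens of a
   Hausdorff space the co-atoms are the complements of points, so x |-> {U. x notin U} is a
   homeomorphism. A frame homomorphism h pulls maximal ideals back to maximal ideals because
   conjunctive normal frames are regular: if h(x) is not below a co-atom m, then neither is h(y) for
   some y with z \<squnion> x = 1 and z \<sqinter> y = 0, so h(z) is below m by primality. *)

theory Submission
  imports Defs
begin

section \<open>Frames as a locale\<close>

text \<open>A locale form of \<open>frame\<close>, so that the theory of
  \<open>complete_lattice\<close> becomes available by interpretation. The locales down to
  \<open>T1_frame\<close> add the hypotheses in the order in which the proof needs them.\<close>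

locale frame_lattice = complete_lattice L for L :: "'b gorder" (structure) +
  assumes meet_sup_distrib:
    "a \<in> carrier L \<Longrightarrow> S \<subseteq> carrier L \<Longrightarrow> a \<sqinter> (\<Squnion>S) = \<Squnion>((\<lambda>s. a \<sqinter> s) ` S)"

lemma frame_iff_locale: "frame F \<longleftrightarrow> frame_lattice F"
  unfolding frame_def frame_lattice_def frame_lattice_axioms_def by blast

locale compact_frame_lattice = frame_lattice +
  assumes compact: "S \<subseteq> carrier L \<Longrightarrow> \<Squnion>S = \<top> \<Longrightarrow> \<exists>S'. S' \<subseteq> S \<and> finite S' \<and> \<Squnion>S' = \<top>"

lemma compact_frame_iff_locale: "compact_frame F \<longleftrightarrow> compact_frame_lattice F"
  unfolding compact_frame_def frame_iff_locale compact_frame_lattice_def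
    compact_frame_lattice_axioms_def by blast

locale T1_frame = compact_frame_lattice +
  assumes conjunctive: "conjunctive L"
    and normal: "normal_lattice L"

lemma T1_frame_iff: "T1_frame F \<longleftrightarrow> compact_frame F \<and> conjunctive F \<and> normal_lattice F"
  unfolding T1_frame_def T1_frame_axioms_def compact_frame_iff_locale by blast

lemma ob_T1Frm_n: "F \<in> cat_ob T1Frm_n \<longleftrightarrow> T1_frame F"
  unfolding T1_frame_iff by (simp add: T1Frm_n_def)

lemma lattice_ideal_down: "lattice_ideal F I \<Longrightarrow> a \<in> I \<Longrightarrow> b \<in> carrier F \<Longrightarrow> b \<sqsubseteq>\<^bsub>F\<^esub> a \<Longrightarrow> b \<in> I"
  by (auto simp: lattice_ideal_def)

definition principal_ideal :: "'b gorder \<Rightarrow> 'b \<Rightarrow> 'b set" where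
  "principal_ideal F a = {x \<in> carrier F. x \<sqsubseteq>\<^bsub>F\<^esub> a}"

section \<open>Suprema, joins and distributivity in a frame\<close>

context frame_lattice
begin

lemma sup_empty_eq: "\<Squnion>{} = \<bottom>"
  using weak.weak_sup_empty by (simp add: eq_is_equal)

lemma sup_insert_eq: "a \<in> carrier L \<Longrightarrow> A \<subseteq> carrier L \<Longrightarrow> \<Squnion>(insert a A) = a \<squnion> \<Squnion>A"
  using weak.weak_sup_insert[of a A] by (simp add: eq_is_equal)

lemma sup_le_iff:
  assumes "A \<subseteq> carrier L" "z \<in> carrier L"
  shows "\<Squnion>A \<sqsubseteq> z \<longleftrightarrow> (\<forall>a\<in>A. a \<sqsubseteq> z)"
proof
  show "\<Squnion>A \<sqsubseteq> z \<Longrightarrow> \<forall>a\<in>A. a \<sqsubseteq> z"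
    using assms sup_upper[of A] sup_closed[of A] le_trans[of _ "\<Squnion>A" z] by auto
  show "\<forall>a\<in>A. a \<sqsubseteq> z \<Longrightarrow> \<Squnion>A \<sqsubseteq> z"
    using sup_least[of A z] assms by simp
qed

lemma join_le_iff:
  assumes "a \<in> carrier L" "b \<in> carrier L" "z \<in> carrier L"
  shows "a \<squnion> b \<sqsubseteq> z \<longleftrightarrow> a \<sqsubseteq> z \<and> b \<sqsubseteq> z"
  using assms by (meson join_closed join_le join_left join_right le_trans)

lemma top_le_iff: "a \<in> carrier L \<Longrightarrow> \<top> \<sqsubseteq> a \<longleftrightarrow> a = \<top>"
  using le_antisym top_closed top_higher by blast

lemma meet_join_distrib:
  assumes "a \<in> carrier L" "b \<in> carrier L" "c \<in> carrier L"
  shows "a \<sqinter> (b \<squnion> c) = (a \<sqinter> b) \<squnion> (a \<sqinter> c)"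
  using meet_sup_distrib[of a "{b, c}"] assms by (simp add: join_def)

text \<open>By distributivity a is the join of \<open>a \<sqinter> b\<close> and
  \<open>a \<sqinter> m\<close>, so it lies below \<open>(a \<sqinter> b) \<squnion> m\<close>. This
  element is then above both a and m, whose join is top. The lemma is what makes co-atoms
  prime.\<close>

lemma join_top_meet:
  assumes car: "a \<in> carrier L" "b \<in> carrier L" "m \<in> carrier L"
    and a: "a \<squnion> m = \<top>" and b: "b \<squnion> m = \<top>"
  shows "(a \<sqinter> b) \<squnion> m = \<top>"
proof -
  let ?j = "(a \<sqinter> b) \<squnion> m"
  have jcar: "?j \<in> carrier L" using car by simp
  have "a \<sqinter> (b \<squnion> m) = (a \<sqinter> b) \<squnion> (a \<sqinter> m)"
    using car by (rule meet_join_distrib)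
  moreover have "a \<sqinter> (b \<squnion> m) = a"
    using top_meet[of a] car by (simp add: b eq_is_equal meet_comm[of L a])
  moreover have "(a \<sqinter> b) \<squnion> (a \<sqinter> m) \<sqsubseteq> ?j"
    using car le_trans[of "a \<sqinter> m" m ?j]
    by (simp add: join_le_iff join_left join_right meet_right)
  ultimately have "a \<sqsubseteq> ?j" by simp
  moreover have "m \<sqsubseteq> ?j" using car by (simp add: join_right)
  ultimately have "\<top> \<sqsubseteq> ?j" using car jcar by (metis a join_le)
  then show ?thesis using jcar top_le_iff by blast
qed

section \<open>Ideals, Zorn's lemma and co-atoms\<close>

lemma ideal_finite_sup:
  assumes I: "lattice_ideal L I" and S: "finite S" "S \<subseteq> I"
  shows "\<Squnion>S \<in> I"
  using S
proof (induction S)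
  case empty
  then show ?case using I by (simp add: sup_empty_eq lattice_ideal_def)
next
  case (insert x S)
  moreover have "I \<subseteq> carrier L" using I by (simp add: lattice_ideal_def)
  ultimately have "\<Squnion>(insert x S) = x \<squnion> \<Squnion>S"
    by (intro sup_insert_eq) auto
  then show ?case using insert I by (simp add: lattice_ideal_def)
qed

lemma ideal_eq_carrier_iff:
  assumes "lattice_ideal L I"
  shows "I = carrier L \<longleftrightarrow> \<top> \<in> I"
  using assms unfolding lattice_ideal_def by (metis subset_antisym subsetI top_closed top_higher)

lemma lattice_ideal_principal:
  assumes "a \<in> carrier L"
  shows "lattice_ideal L (principal_ideal L a)"
  using assms unfolding lattice_ideal_def principal_ideal_def
  by (auto simp: join_le_iff) (meson le_trans)

lemma principal_proper_iff:
  "a \<in> carrier L \<Longrightarrow> principal_ideal L a \<noteq> carrier L \<longleftrightarrow> a \<noteq> \<top>"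
  using ideal_eq_carrier_iff[OF lattice_ideal_principal] top_le_iff
  by (auto simp: principal_ideal_def)

text \<open>Zorn's lemma on the proper ideals above I. The union of a nonempty chain is an ideal
  because two of its elements lie in a common member.\<close>

lemma maximal_ideal_extension:
  assumes I: "lattice_ideal L I" "I \<noteq> carrier L"
  shows "\<exists>M \<in> maximal_ideals L. I \<subseteq> M"
proof -
  let ?A = "{J. lattice_ideal L J \<and> J \<noteq> carrier L \<and> I \<subseteq> J}"
  have "\<exists>M\<in>?A. \<forall>X\<in>?A. M \<subseteq> X \<longrightarrow> X = M"
  proof (rule subset_Zorn_nonempty)
    show "?A \<noteq> {}" using I by blast
    fix C assume C: "C \<noteq> {}" "subset.chain ?A C"
    have CA: "C \<subseteq> ?A" and tot: "\<And>X Y. X \<in> C \<Longrightarrow> Y \<in> C \<Longrightarrow> X \<subseteq> Y \<or> Y \<subseteq> X"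
      using C(2) by (auto simp: subset_chain_def)
    have ideal: "lattice_ideal L X" if "X \<in> C" for X using CA that by blast
    have "lattice_ideal L (\<Union>C)"
      unfolding lattice_ideal_def
    proof (intro conjI ballI impI)
      show "\<Union>C \<subseteq> carrier L" using ideal unfolding lattice_ideal_def by blast
      show "\<bottom> \<in> \<Union>C" using ideal C(1) by (auto simp: lattice_ideal_def)
    next
      fix a b assume "a \<in> \<Union>C" "b \<in> \<Union>C"
      then obtain X where "X \<in> C" "a \<in> X" "b \<in> X" using tot by blast
      then show "a \<squnion> b \<in> \<Union>C" using ideal by (auto simp: lattice_ideal_def)
    next
      fix a b assume "a \<in> \<Union>C" "b \<in> carrier L" "b \<sqsubseteq> a"
      then obtain X where "X \<in> C" "b \<in> X" using lattice_ideal_down[OF ideal] by auto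
      then show "b \<in> \<Union>C" by blast
    qed
    \<comment> \<open>An ideal is proper exactly when it omits the top element, a condition that
      survives unions.\<close>
    moreover have "\<top> \<notin> \<Union>C" using CA ideal_eq_carrier_iff[OF ideal] by auto
    moreover have "I \<subseteq> \<Union>C" using CA C(1) by auto
    ultimately show "\<Union>C \<in> ?A" using ideal_eq_carrier_iff by auto
  qed
  then obtain M where M: "M \<in> ?A" and max: "\<forall>X\<in>?A. M \<subseteq> X \<longrightarrow> X = M"
    by (rule bexE)
  have "M \<in> maximal_ideals L"
    unfolding maximal_ideals_def using M max by auto
  then show ?thesis using M by blast
qed

text \<open>An element above a co-atom is the co-atom or top, so \<open>a \<squnion> m\<close> has
  only these two possible values. The lemma turns order relations into joins equal to top, the form
  in which conjunctivity and normality are stated.\<close>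

lemma coatom_join_top_iff:
  assumes m: "coatom L m" and a: "a \<in> carrier L"
  shows "a \<squnion> m = \<top> \<longleftrightarrow> \<not> a \<sqsubseteq> m"
proof -
  have mc: "m \<in> carrier L" "m \<noteq> \<top>" using m by (auto simp: coatom_def)
  have "m \<sqsubseteq> a \<squnion> m" "a \<sqsubseteq> a \<squnion> m" using a mc by (simp_all add: join_left join_right)
  moreover have "a \<squnion> m = m" if "a \<sqsubseteq> m"
    using that a mc calculation by (intro le_antisym) (simp_all add: join_le_iff)
  moreover have "a \<squnion> m = m" if "a \<squnion> m \<noteq> \<top>"
    using m that calculation(1) a mc unfolding coatom_def by simp
  ultimately show ?thesis using mc by metis
qed

text \<open>Contrapositive of \<open>join_top_meet\<close>: if neither a nor b is below m, both join
  with m to top, and hence so does their meet.\<close>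

lemma coatom_prime:
  assumes m: "coatom L m" and a: "a \<in> carrier L" and b: "b \<in> carrier L"
  shows "a \<sqinter> b \<sqsubseteq> m \<longleftrightarrow> a \<sqsubseteq> m \<or> b \<sqsubseteq> m"
proof
  have mc: "m \<in> carrier L" using m by (auto simp: coatom_def)
  show "a \<sqsubseteq> m \<or> b \<sqsubseteq> m" if "a \<sqinter> b \<sqsubseteq> m"
    using that join_top_meet[OF a b mc] coatom_join_top_iff[OF m] a b by auto
  show "a \<sqinter> b \<sqsubseteq> m" if "a \<sqsubseteq> m \<or> b \<sqsubseteq> m"
    using that a b mc by (meson le_trans meet_closed meet_left meet_right)
qed

end

section \<open>Maximal ideals of a compact frame\<close>

context compact_frame_lattice
begin

text \<open>If the supremum were top, compactness would give a finite part of I with supremum top;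
  ideals are closed under finite suprema, so top would belong to I.\<close>

lemma ideal_sup_neq_top:
  assumes I: "lattice_ideal L I" "I \<noteq> carrier L"
  shows "\<Squnion>I \<noteq> \<top>"
proof
  assume "\<Squnion>I = \<top>"
  then obtain S where "S \<subseteq> I" "finite S" "\<Squnion>S = \<top>"
    using compact[of I] I by (auto simp: lattice_ideal_def)
  then have "\<top> \<in> I" using ideal_finite_sup[OF I(1)] by metis
  then show False using ideal_eq_carrier_iff I by blast
qed

text \<open>A proper ideal J above the principal ideal has a supremum that is above m and different
  from top. This supremum must be m, so every element of J is below m.\<close>

lemma principal_coatom_maximal:
  assumes m: "coatom L m"
  shows "principal_ideal L m \<in> maximal_ideals L"
proof -
  have mc: "m \<in> carrier L" "m \<noteq> \<top>" using m by (auto simp: coatom_def)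
  have "J = principal_ideal L m"
    if J: "lattice_ideal L J" "J \<noteq> carrier L" "principal_ideal L m \<subseteq> J" for J
  proof -
    have Jc: "J \<subseteq> carrier L" using J by (simp add: lattice_ideal_def)
    have "m \<in> J" using J mc by (auto simp: principal_ideal_def)
    then have "m \<sqsubseteq> \<Squnion>J" using Jc by (simp add: sup_upper)
    then have "\<Squnion>J = m"
      using m ideal_sup_neq_top[OF J(1,2)] Jc unfolding coatom_def by simp
    then have "J \<subseteq> principal_ideal L m" using Jc sup_upper[OF Jc] by (auto simp: principal_ideal_def)
    then show ?thesis using J by blast
  qed
  then show ?thesis
    using mc unfolding maximal_ideals_def
    by (auto simp: lattice_ideal_principal principal_proper_iff)
qed

lemma maximal_ideal_coatom:
  assumes M: "M \<in> maximal_ideals L"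
  shows "coatom L (\<Squnion>M)" "M = principal_ideal L (\<Squnion>M)"
proof -
  have I: "lattice_ideal L M" "M \<noteq> carrier L" using M by (auto simp: maximal_ideals_def)
  have Mc: "M \<subseteq> carrier L" using I by (simp add: lattice_ideal_def)
  have top: "\<Squnion>M \<noteq> \<top>" using ideal_sup_neq_top[OF I] .
  have sub: "M \<subseteq> principal_ideal L x" if "x \<in> carrier L" "\<Squnion>M \<sqsubseteq> x" for x
    using that Mc sup_le_iff[OF Mc] by (auto simp: principal_ideal_def)
  \<comment> \<open>Both claims rest on this: any x other than top above the supremum of M generates
    a proper ideal containing M, and M is maximal. The case where x is the supremum itself shows
    that M is principal; a general x gives maximality of the supremum.\<close>
  have eq: "principal_ideal L x = M" if "x \<in> carrier L" "\<Squnion>M \<sqsubseteq> x" "x \<noteq> \<top>" for x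
  proof -
    have "lattice_ideal L (principal_ideal L x)" "principal_ideal L x \<noteq> carrier L"
      using that lattice_ideal_principal principal_proper_iff by simp_all
    then show ?thesis using M sub[OF that(1,2)] by (simp add: maximal_ideals_def)
  qed
  show "M = principal_ideal L (\<Squnion>M)" using eq[of "\<Squnion>M"] top Mc by simp
  show "coatom L (\<Squnion>M)"
    unfolding coatom_def
  proof (intro conjI ballI impI)
    fix x assume x: "x \<in> carrier L" "x \<noteq> \<top> \<and> \<Squnion>M \<sqsubseteq> x"
    then have "x \<in> M" using eq[of x] by (auto simp: principal_ideal_def)
    then have "x \<sqsubseteq> \<Squnion>M" using Mc by (simp add: sup_upper)
    then show "x = \<Squnion>M" using x Mc by (intro le_antisym) simp_all
  qed (use Mc top in auto)
qed

lemma maximal_ideals_eq: "maximal_ideals L = principal_ideal L ` {m. coatom L m}"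
proof
  show "maximal_ideals L \<subseteq> principal_ideal L ` {m. coatom L m}"
    using maximal_ideal_coatom by (intro subsetI image_eqI) auto
  show "principal_ideal L ` {m. coatom L m} \<subseteq> maximal_ideals L"
    using principal_coatom_maximal by auto
qed

lemma coatom_above:
  assumes a: "a \<in> carrier L" "a \<noteq> \<top>"
  obtains m where "coatom L m" "a \<sqsubseteq> m"
proof -
  obtain M where M: "M \<in> maximal_ideals L" "principal_ideal L a \<subseteq> M"
    using maximal_ideal_extension lattice_ideal_principal principal_proper_iff a by metis
  have "a \<in> principal_ideal L a" using a by (simp add: principal_ideal_def)
  then have "a \<in> principal_ideal L (\<Squnion>M)" using M maximal_ideal_coatom(2) by blast
  then show thesis using that maximal_ideal_coatom(1)[OF M(1)] by (auto simp: principal_ideal_def)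
qed

text \<open>Whether a join is top is decided by co-atoms, since every other element lies below one.
  So a joins with c to top whenever the meet of the co-atoms above a does, and conjunctivity then
  puts that meet below a. For the converse it suffices to test the hypothesis at co-atoms.\<close>

lemma conjunctive_iff_coatomistic: "conjunctive L \<longleftrightarrow> coatomistic L"
proof
  assume conj: "conjunctive L"
  show "coatomistic L"
    unfolding coatomistic_def
  proof
    fix a assume a: "a \<in> carrier L"
    let ?A = "{m. coatom L m \<and> a \<sqsubseteq> m}"
    have A: "?A \<subseteq> carrier L" by (auto simp: coatom_def)
    have "a \<squnion> c = \<top>" if c: "c \<in> carrier L" "\<Sqinter>?A \<squnion> c = \<top>" for c
    proof (rule ccontr)
      assume "a \<squnion> c \<noteq> \<top>"
      then obtain m where m: "coatom L m" "a \<squnion> c \<sqsubseteq> m" 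
        using coatom_above[of "a \<squnion> c"] a c by auto
      then have mc: "m \<in> carrier L" "m \<noteq> \<top>" by (auto simp: coatom_def)
      have "a \<sqsubseteq> m" "c \<sqsubseteq> m" using m mc a c by (simp_all add: join_le_iff)
      then have "\<Sqinter>?A \<sqsubseteq> m" using m inf_lower[OF A] by simp
      then have "\<Sqinter>?A \<squnion> c \<sqsubseteq> m"
        using \<open>c \<sqsubseteq> m\<close> inf_closed[OF A] c(1) mc(1) by (rule join_le)
      then show False using c mc top_le_iff by simp
    qed
    then have "\<Sqinter>?A \<sqsubseteq> a" using conj A a unfolding conjunctive_def by simp
    moreover have "a \<sqsubseteq> \<Sqinter>?A" by (rule inf_greatest[OF A a]) simp
    ultimately show "a = \<Sqinter>?A" using a inf_closed[OF A] by (intro le_antisym)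
  qed
next
  assume coat: "coatomistic L"
  show "conjunctive L"
    unfolding conjunctive_def
  proof (intro ballI impI)
    fix a b assume a: "a \<in> carrier L" and b: "b \<in> carrier L"
      and ab: "\<forall>c\<in>carrier L. a \<squnion> c = \<top> \<longrightarrow> b \<squnion> c = \<top>"
    let ?B = "{m. coatom L m \<and> b \<sqsubseteq> m}"
    have B: "?B \<subseteq> carrier L" by (auto simp: coatom_def)
    \<comment> \<open>Take c to be m and argue by contraposition: \<open>b \<squnion> m\<close> is
      not top because b is below m, so \<open>a \<squnion> m\<close> is not top either.\<close>
    have "a \<sqsubseteq> m" if m: "coatom L m" "b \<sqsubseteq> m" for m
      using ab m coatom_join_top_iff[OF m(1)] a b unfolding coatom_def by blast
    then have "a \<sqsubseteq> \<Sqinter>?B" using B a by (intro inf_greatest) auto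
    then show "a \<sqsubseteq> b" using coat b unfolding coatomistic_def by metis
  qed
qed

end

section \<open>The spectrum\<close>

text \<open>These are the generators of \<open>Max_space\<close>. As a function of a, this is also
  the component at F of the natural isomorphism from the identity to
  \<open>D \<circ> Max\<close>.\<close>

definition basic_open :: "'b gorder \<Rightarrow> 'b \<Rightarrow> 'b set set" where
  "basic_open F a = {M \<in> maximal_ideals F. a \<notin> M}"

context compact_frame_lattice
begin

lemma mem_basic_open_principal:
  "coatom L m \<Longrightarrow> a \<in> carrier L \<Longrightarrow> principal_ideal L m \<in> basic_open L a \<longleftrightarrow> \<not> a \<sqsubseteq> m"
  using principal_coatom_maximal by (auto simp: basic_open_def principal_ideal_def)

text \<open>Every maximal ideal is principal over a co-atom, so equations between sets of maximal
  ideals reduce to order statements about co-atoms.\<close>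

lemma subset_maximal_idealsI:
  assumes "A \<subseteq> maximal_ideals L" "B \<subseteq> maximal_ideals L"
    and "\<And>m. coatom L m \<Longrightarrow> principal_ideal L m \<in> A \<longleftrightarrow> principal_ideal L m \<in> B"
  shows "A = B"
  using assms unfolding maximal_ideals_eq by blast

lemma basic_open_subset: "basic_open L a \<subseteq> maximal_ideals L"
  by (auto simp: basic_open_def)

lemma basic_open_top: "basic_open L \<top> = maximal_ideals L"
  unfolding basic_open_def maximal_ideals_def using ideal_eq_carrier_iff by blast

lemma topspace_Max_space: "topspace (Max_space L) = maximal_ideals L"
  using basic_open_top unfolding Max_space_def topology_generated_by_topspace basic_open_def
  by blast

lemma basic_open_meet:
  assumes "a \<in> carrier L" "b \<in> carrier L"
  shows "basic_open L (a \<sqinter> b) = basic_open L a \<inter> basic_open L b"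
  by (rule subset_maximal_idealsI)
    (use assms basic_open_subset in \<open>auto simp: mem_basic_open_principal coatom_prime\<close>)

text \<open>Maximal ideals are principal here, so they are closed under arbitrary suprema: m bounds
  the supremum of S exactly when it bounds each member.\<close>

lemma basic_open_sup:
  assumes "S \<subseteq> carrier L"
  shows "basic_open L (\<Squnion>S) = \<Union>(basic_open L ` S)"
proof (rule subset_maximal_idealsI)
  fix m assume m: "coatom L m"
  then have "m \<in> carrier L" by (simp add: coatom_def)
  then show "principal_ideal L m \<in> basic_open L (\<Squnion>S) \<longleftrightarrow> principal_ideal L m \<in> \<Union>(basic_open L ` S)"
    using m assms sup_le_iff[OF assms] mem_basic_open_principal[OF m]
    by (auto simp: subset_iff)
qed (use basic_open_subset in auto)

text \<open>The generators are already closed under binary intersections (meets) and arbitrary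
  unions (suprema), so generating a topology from them adds nothing new.\<close>

lemma openin_Max_space_iff: "openin (Max_space L) U \<longleftrightarrow> (\<exists>a\<in>carrier L. U = basic_open L a)"
proof
  assume "openin (Max_space L) U"
  then have "generate_topology_on {{M \<in> maximal_ideals L. a \<notin> M} |a. a \<in> carrier L} U"
    unfolding Max_space_def by (simp add: openin_topology_generated_by)
  then show "\<exists>a\<in>carrier L. U = basic_open L a"
  proof induction
    case Empty
    have "basic_open L \<bottom> = {}" using basic_open_sup[of "{}"] by (simp add: sup_empty_eq)
    then show ?case using bottom_closed by metis
  next
    case (Int U V)
    then show ?case using basic_open_meet meet_closed by metis
  next
    case (UN K)
    let ?S = "{a \<in> carrier L. basic_open L a \<in> K}"
    have "K = basic_open L ` ?S" using UN by auto
    then have "\<Union>K = basic_open L (\<Squnion>?S)" using basic_open_sup[of ?S] by auto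
    then show ?case by (intro bexI[of _ "\<Squnion>?S"]) auto
  next
    case (Basis U)
    then show ?case by (auto simp: basic_open_def)
  qed
next
  assume "\<exists>a\<in>carrier L. U = basic_open L a"
  then show "openin (Max_space L) U"
    unfolding Max_space_def basic_open_def by (auto intro: topology_generated_by_Basis)
qed

text \<open>An open cover consists of basic opens and so corresponds to a set of frame elements.
  Their supremum is top, since a co-atom above it would be an uncovered point. Compactness of the
  frame then selects a finite subcover.\<close>

lemma compact_Max_space: "compact_space (Max_space L)"
  unfolding compact_space_alt
proof (intro allI impI)
  fix K assume K: "(\<forall>U\<in>K. openin (Max_space L) U) \<and> topspace (Max_space L) \<subseteq> \<Union>K"
  let ?S = "{a \<in> carrier L. basic_open L a \<in> K}"
  have "K = basic_open L ` ?S" using K openin_Max_space_iff by auto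
  then have "basic_open L (\<Squnion>?S) = \<Union>K" using basic_open_sup[of ?S] by auto
  then have cover: "basic_open L (\<Squnion>?S) = maximal_ideals L"
    using K basic_open_subset[of "\<Squnion>?S"] by (simp add: topspace_Max_space)
  have Sc: "\<Squnion>?S \<in> carrier L" by auto
  have "\<Squnion>?S = \<top>"
  proof (rule ccontr)
    assume "\<Squnion>?S \<noteq> \<top>"
    then obtain m where m: "coatom L m" "\<Squnion>?S \<sqsubseteq> m" using coatom_above Sc by metis
    then show False
      using cover mem_basic_open_principal[OF m(1) Sc] principal_coatom_maximal[OF m(1)] by simp
  qed
  then obtain T where T: "T \<subseteq> ?S" "finite T" "\<Squnion>T = \<top>" using compact[of ?S] by auto
  then have "maximal_ideals L = \<Union>(basic_open L ` T)"
    using basic_open_sup[of T] basic_open_top by auto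
  then show "\<exists>F. finite F \<and> F \<subseteq> K \<and> topspace (Max_space L) \<subseteq> \<Union>F"
    using T topspace_Max_space by (intro exI[of _ "basic_open L ` T"]) auto
qed

text \<open>Distinct co-atoms m and n join to top, and normality supplies c and d with meet bottom.
  As c joins with m to top, c is not below m, so its basic open contains the point of m; likewise
  for d and n. The two basic opens are disjoint because their intersection is that of
  bottom.\<close>

lemma Hausdorff_Max_space:
  assumes "normal_lattice L"
  shows "Hausdorff_space (Max_space L)"
  unfolding Hausdorff_space_def
proof (intro allI impI)
  fix M N assume MN: "M \<in> topspace (Max_space L) \<and> N \<in> topspace (Max_space L) \<and> M \<noteq> N"
  then obtain m n where m: "coatom L m" "M = principal_ideal L m" and n: "coatom L n" "N = principal_ideal L n"
    by (auto simp: topspace_Max_space maximal_ideals_eq)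
  have car: "m \<in> carrier L" "n \<in> carrier L" using m n by (auto simp: coatom_def)
  have "\<not> m \<sqsubseteq> n" using m n MN unfolding coatom_def by metis
  then have "m \<squnion> n = \<top>" using coatom_join_top_iff n car by blast
  then obtain c d where cd: "c \<in> carrier L" "d \<in> carrier L" "c \<squnion> m = \<top>" "n \<squnion> d = \<top>" "c \<sqinter> d = \<bottom>"
    using assms car unfolding normal_lattice_def by blast
  have "M \<in> basic_open L c" "N \<in> basic_open L d"
    using cd m n coatom_join_top_iff mem_basic_open_principal by (metis join_comm)+
  moreover have "basic_open L c \<inter> basic_open L d = {}"
    using basic_open_meet[of c d] cd basic_open_sup[of "{}"] by (simp add: sup_empty_eq)
  ultimately show "\<exists>U V. openin (Max_space L) U \<and> openin (Max_space L) V \<and> M \<in> U \<and> N \<in> V \<and> disjnt U V"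
    using cd openin_Max_space_iff
    by (intro exI[of _ "basic_open L c"] exI[of _ "basic_open L d"]) (auto simp: disjnt_def)
qed

end

section \<open>Consequences of conjunctivity and normality\<close>

context T1_frame
begin

text \<open>The basic open of a determines which co-atoms are above a, and in a co-atomistic frame a
  is their meet.\<close>

lemma basic_open_inj:
  assumes a: "a \<in> carrier L" and b: "b \<in> carrier L" and eq: "basic_open L a = basic_open L b"
  shows "a = b"
proof -
  have "a \<sqsubseteq> m \<longleftrightarrow> b \<sqsubseteq> m" if "coatom L m" for m
    using mem_basic_open_principal[OF that a] mem_basic_open_principal[OF that b] eq by simp
  then have "{m. coatom L m \<and> a \<sqsubseteq> m} = {m. coatom L m \<and> b \<sqsubseteq> m}" by auto
  moreover have "coatomistic L" using conjunctive conjunctive_iff_coatomistic by blast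
  ultimately show ?thesis using a b unfolding coatomistic_def by metis
qed

text \<open>\<open>z\<close> witnesses that \<open>y\<close> is well inside \<open>x\<close>.\<close>

lemma regular:
  assumes x: "x \<in> carrier L"
  shows "x \<sqsubseteq> \<Squnion>{y \<in> carrier L. \<exists>z\<in>carrier L. z \<squnion> x = \<top> \<and> z \<sqinter> y = \<bottom>}" (is "x \<sqsubseteq> \<Squnion>?S")
proof -
  have S: "?S \<subseteq> carrier L" by auto
  \<comment> \<open>By conjunctivity, only elements c joining with x to top have to be tested.
    Normality for x and c yields p and q; p witnesses that q belongs to \<open>?S\<close>, and q
    already joins with c to top.\<close>
  have "\<Squnion>?S \<squnion> c = \<top>" if c: "c \<in> carrier L" "x \<squnion> c = \<top>" for c
  proof -
    obtain p q where pq: "p \<in> carrier L" "q \<in> carrier L" "p \<squnion> x = \<top>" "c \<squnion> q = \<top>" "p \<sqinter> q = \<bottom>"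
      using normal x c unfolding normal_lattice_def by blast
    then have "q \<sqsubseteq> \<Squnion>?S" using sup_upper[OF S] by auto
    moreover have w: "\<Squnion>?S \<in> carrier L" "\<Squnion>?S \<squnion> c \<in> carrier L"
      using sup_closed[OF S] c by simp_all
    ultimately have "q \<sqsubseteq> \<Squnion>?S \<squnion> c"
      using le_trans[of q "\<Squnion>?S" "\<Squnion>?S \<squnion> c"] join_left[of "\<Squnion>?S" c] c pq by blast
    then have "c \<squnion> q \<sqsubseteq> \<Squnion>?S \<squnion> c"
      using join_le[of c "\<Squnion>?S \<squnion> c" q] join_right[OF w(1) c(1)] w c pq by blast
    then show ?thesis using pq w top_le_iff by simp
  qed
  then show ?thesis using conjunctive x S unfolding conjunctive_def by simp
qed

end

section \<open>Frame homomorphisms\<close>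

lemma frame_hom_closed: "frame_hom F G h \<Longrightarrow> a \<in> carrier F \<Longrightarrow> h a \<in> carrier G"
  unfolding frame_hom_def by blast

lemma frame_hom_sup: "frame_hom F G h \<Longrightarrow> S \<subseteq> carrier F \<Longrightarrow> h (\<Squnion>\<^bsub>F\<^esub> S) = \<Squnion>\<^bsub>G\<^esub> (h ` S)"
  unfolding frame_hom_def by blast

lemma frame_hom_meet:
  "frame_hom F G h \<Longrightarrow> a \<in> carrier F \<Longrightarrow> b \<in> carrier F \<Longrightarrow> h (a \<sqinter>\<^bsub>F\<^esub> b) = h a \<sqinter>\<^bsub>G\<^esub> h b"
  unfolding frame_hom_def by blast

lemma frame_hom_top: "frame_hom F G h \<Longrightarrow> h \<top>\<^bsub>F\<^esub> = \<top>\<^bsub>G\<^esub>"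
  unfolding frame_hom_def by blast

lemma frame_hom_join:
  "frame_hom F G h \<Longrightarrow> a \<in> carrier F \<Longrightarrow> b \<in> carrier F \<Longrightarrow> h (a \<squnion>\<^bsub>F\<^esub> b) = h a \<squnion>\<^bsub>G\<^esub> h b"
  using frame_hom_sup[of F G h "{a, b}"] by (simp add: join_def)

text \<open>Morphisms of \<open>T1Frm_n\<close> are restricted to the carrier, whereas the
  homomorphism laws are easier to check for unrestricted functions. The laws only evaluate the map
  at suprema, meets and top, all of which lie in the carrier of F.\<close>

lemma frame_hom_cong:
  assumes "frame_lattice F" "frame_hom F G h" "\<And>a. a \<in> carrier F \<Longrightarrow> k a = h a"
  shows "frame_hom F G k"
proof -
  interpret F: frame_lattice F by fact
  have "k ` S = h ` S" if "S \<subseteq> carrier F" for S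
    using that assms(3) by (intro image_cong) auto
  then show ?thesis
    using assms(2,3) by (auto simp: frame_hom_def)
qed

lemma frame_hom_id: "frame_hom F F (\<lambda>a. a)"
  unfolding frame_hom_def by auto

lemma frame_hom_compose:
  assumes "frame_hom F G h" "frame_hom G H k"
  shows "frame_hom F H (\<lambda>a. k (h a))"
proof -
  have "h ` S \<subseteq> carrier G" if "S \<subseteq> carrier F" for S
    using that frame_hom_closed[OF assms(1)] by blast
  then show ?thesis
    using assms unfolding frame_hom_def by (auto simp: image_image Pi_iff)
qed

text \<open>A bijective frame homomorphism has a homomorphic inverse: each law for the inverse
  follows by transporting the corresponding law for h through the bijection.\<close>

lemma frame_isos_inv_into:
  assumes F: "frame_lattice F" and G: "frame_lattice G" and h: "frame_hom F G h"
    and bij: "bij_betw h (carrier F) (carrier G)"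
  shows "frame_isos F G h (inv_into (carrier F) h)"
proof -
  interpret F: frame_lattice F by fact
  interpret G: frame_lattice G by fact
  let ?k = "inv_into (carrier F) h"
  have kh: "?k (h a) = a" if "a \<in> carrier F" for a
    using bij that by (simp add: bij_betw_inv_into_left)
  have hk: "h (?k b) = b" if "b \<in> carrier G" for b
    using bij that by (simp add: bij_betw_inv_into_right)
  have k: "?k b \<in> carrier F" if "b \<in> carrier G" for b
    using bij that by (simp add: bij_betw_def inv_into_into)
  have "frame_hom G F ?k"
    unfolding frame_hom_def
  proof (intro conjI allI ballI impI)
    show "?k \<in> carrier G \<rightarrow> carrier F" using k by simp
    show "?k \<top>\<^bsub>G\<^esub> = \<top>\<^bsub>F\<^esub>" using kh[of "\<top>\<^bsub>F\<^esub>"] frame_hom_top[OF h] by simp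
  next
    fix S assume S: "S \<subseteq> carrier G"
    have kS: "?k ` S \<subseteq> carrier F" using S k by auto
    have "(\<lambda>b. h (?k b)) ` S = (\<lambda>b. b) ` S" using S hk by (intro image_cong) auto
    then have "h ` ?k ` S = S" by (simp add: image_image)
    then have "h (\<Squnion>\<^bsub>F\<^esub> (?k ` S)) = \<Squnion>\<^bsub>G\<^esub> S" using frame_hom_sup[OF h kS] by simp
    then show "?k (\<Squnion>\<^bsub>G\<^esub> S) = \<Squnion>\<^bsub>F\<^esub> (?k ` S)" using kh F.sup_closed[OF kS] by metis
  next
    fix a b assume ab: "a \<in> carrier G" "b \<in> carrier G"
    then have "h (?k a \<sqinter>\<^bsub>F\<^esub> ?k b) = a \<sqinter>\<^bsub>G\<^esub> b" using frame_hom_meet[OF h] k hk by simp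
    then show "?k (a \<sqinter>\<^bsub>G\<^esub> b) = ?k a \<sqinter>\<^bsub>F\<^esub> ?k b"
      using kh F.meet_closed[OF k[OF ab(1)] k[OF ab(2)]] by metis
  qed
  then show ?thesis using h kh hk unfolding frame_isos_def by blast
qed

section \<open>Pulling back ideals along frame homomorphisms\<close>

lemma pullback_ideal:
  assumes F: "frame_lattice F" and G: "frame_lattice G" and h: "frame_hom F G h"
    and I: "lattice_ideal G I"
  shows "lattice_ideal F {a \<in> carrier F. h a \<in> I}"
proof -
  interpret F: frame_lattice F by fact
  interpret G: frame_lattice G by fact
  have bot: "h \<bottom>\<^bsub>F\<^esub> = \<bottom>\<^bsub>G\<^esub>"
    using frame_hom_sup[OF h, of "{}"] by (simp add: F.sup_empty_eq G.sup_empty_eq)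
  \<comment> \<open>\<open>le_iff_meet\<close> expresses the order by a join equation, so
    preservation of joins gives monotonicity.\<close>
  have mono: "h a \<sqsubseteq>\<^bsub>G\<^esub> h b" if "a \<in> carrier F" "b \<in> carrier F" "a \<sqsubseteq>\<^bsub>F\<^esub> b" for a b
    using frame_hom_join[OF h that(1,2)] that frame_hom_closed[OF h]
    by (simp add: F.le_iff_meet G.le_iff_meet)
  show ?thesis
    using I bot frame_hom_join[OF h] mono frame_hom_closed[OF h]
    unfolding lattice_ideal_def by auto
qed

lemma pullback_maximal_ideal:
  assumes F: "T1_frame F" and G: "compact_frame_lattice G" and h: "frame_hom F G h"
    and M: "M \<in> maximal_ideals G"
  shows "{a \<in> carrier F. h a \<in> M} \<in> maximal_ideals F"
proof -
  interpret F: T1_frame F by fact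
  interpret G: compact_frame_lattice G by fact
  let ?N = "{a \<in> carrier F. h a \<in> M}"
  obtain m where m: "coatom G m" and Mm: "M = principal_ideal G m"
    using M by (auto simp: G.maximal_ideals_eq)
  have mc: "m \<in> carrier G" using m by (simp add: coatom_def)
  have ideal_M: "lattice_ideal G M" "M \<noteq> carrier G" using M by (auto simp: maximal_ideals_def)
  have ideal_N: "lattice_ideal F ?N"
    using pullback_ideal[OF F.frame_lattice_axioms G.frame_lattice_axioms h ideal_M(1)] .
  have "\<top>\<^bsub>F\<^esub> \<notin> ?N"
    using ideal_M G.ideal_eq_carrier_iff frame_hom_top[OF h] by simp
  then have proper: "?N \<noteq> carrier F" using F.ideal_eq_carrier_iff[OF ideal_N] by simp
  \<comment> \<open>Suppose J contains some x outside \<open>?N\<close>. Regularity of F gives a y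
    well inside x with \<open>h y\<close> not below m, and a witness z for this. Primality of m in G
    puts z into \<open>?N\<close>, hence into J, so J contains \<open>z \<squnion> x\<close>, which
    is top.\<close>
  have "J = ?N" if J: "lattice_ideal F J" "J \<noteq> carrier F" "?N \<subseteq> J" for J
  proof (rule ccontr)
    assume "J \<noteq> ?N"
    then obtain x where x: "x \<in> J" "x \<notin> ?N" using J by blast
    have xc: "x \<in> carrier F" using x J by (auto simp: lattice_ideal_def)
    let ?S = "{y \<in> carrier F. \<exists>z\<in>carrier F. z \<squnion>\<^bsub>F\<^esub> x = \<top>\<^bsub>F\<^esub> \<and> z \<sqinter>\<^bsub>F\<^esub> y = \<bottom>\<^bsub>F\<^esub>}"
    have S: "?S \<subseteq> carrier F" by auto
    have hS: "h ` ?S \<subseteq> carrier G" using frame_hom_closed[OF h] by auto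
    have "\<Squnion>\<^bsub>F\<^esub> ?S \<notin> ?N"
      using lattice_ideal_down[OF ideal_N _ xc F.regular[OF xc]] x by blast
    then have "\<not> \<Squnion>\<^bsub>G\<^esub> (h ` ?S) \<sqsubseteq>\<^bsub>G\<^esub> m"
      using F.sup_closed[OF S] G.sup_closed[OF hS] frame_hom_sup[OF h S]
      by (simp add: Mm principal_ideal_def)
    then obtain y where y: "y \<in> ?S" "\<not> h y \<sqsubseteq>\<^bsub>G\<^esub> m" using G.sup_le_iff[OF hS mc] by auto
    then obtain z where z: "y \<in> carrier F" "z \<in> carrier F" "z \<squnion>\<^bsub>F\<^esub> x = \<top>\<^bsub>F\<^esub>" "z \<sqinter>\<^bsub>F\<^esub> y = \<bottom>\<^bsub>F\<^esub>"
      by auto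
    have "h (z \<sqinter>\<^bsub>F\<^esub> y) \<in> M" using ideal_N z(4) by (simp add: lattice_ideal_def)
    then have "h z \<sqinter>\<^bsub>G\<^esub> h y \<sqsubseteq>\<^bsub>G\<^esub> m"
      using frame_hom_meet[OF h z(2,1)] by (simp add: Mm principal_ideal_def)
    then have "h z \<sqsubseteq>\<^bsub>G\<^esub> m"
      using G.coatom_prime[OF m frame_hom_closed[OF h z(2)] frame_hom_closed[OF h z(1)]] y(2)
      by simp
    then have "z \<in> ?N" using frame_hom_closed[OF h] z by (simp add: Mm principal_ideal_def)
    then have "z \<squnion>\<^bsub>F\<^esub> x \<in> J" using J x by (auto simp: lattice_ideal_def)
    then show False using z J F.ideal_eq_carrier_iff by simp
  qed
  then show ?thesis using ideal_N proper unfolding maximal_ideals_def by simp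
qed

section \<open>The frame of open sets\<close>

lemma carrier_open_frame [simp]: "carrier (open_frame X) = {U. openin X U}"
  and le_open_frame [simp]: "U \<sqsubseteq>\<^bsub>open_frame X\<^esub> V \<longleftrightarrow> U \<subseteq> V"
  by (simp_all add: open_frame_def)

lemma complete_lattice_open_frame: "complete_lattice (open_frame X)"
proof -
  interpret partial_order "open_frame X"
    by unfold_locales (auto simp: open_frame_def)
  show ?thesis
  proof (rule complete_latticeI)
    fix A assume A: "A \<subseteq> carrier (open_frame X)"
    have "least (open_frame X) (\<Union>A) (Upper (open_frame X) A)"
      using A by (intro least_UpperI) (auto simp: Upper_def)
    then show "\<exists>s. least (open_frame X) s (Upper (open_frame X) A)" ..
    \<comment> \<open>An intersection of opens may fail to be open, so the infimum is the largest
      open set inside all members of A. For empty A this is the whole space.\<close>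
    let ?I = "\<Union>{U. openin X U \<and> (\<forall>V\<in>A. U \<subseteq> V)}"
    have "greatest (open_frame X) ?I (Lower (open_frame X) A)"
      using A by (intro greatest_LowerI) (auto simp: Lower_def)
    then show "\<exists>i. greatest (open_frame X) i (Lower (open_frame X) A)" ..
  qed
qed

lemma sup_open_frame:
  assumes "A \<subseteq> carrier (open_frame X)"
  shows "\<Squnion>\<^bsub>open_frame X\<^esub> A = \<Union>A"
proof -
  interpret complete_lattice "open_frame X" by (rule complete_lattice_open_frame)
  have "\<Union>A \<in> carrier (open_frame X)" using assms by auto
  then have "\<Squnion>\<^bsub>open_frame X\<^esub> A \<subseteq> \<Union>A" using sup_least[OF assms, of "\<Union>A"] by auto
  moreover have "\<Union>A \<subseteq> \<Squnion>\<^bsub>open_frame X\<^esub> A" using sup_upper[OF assms] by auto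
  ultimately show ?thesis by blast
qed

lemma join_open_frame:
  "openin X U \<Longrightarrow> openin X V \<Longrightarrow> U \<squnion>\<^bsub>open_frame X\<^esub> V = U \<union> V"
  using sup_open_frame[of "{U, V}" X] by (simp add: join_def)

lemma meet_open_frame:
  assumes "openin X U" "openin X V"
  shows "U \<sqinter>\<^bsub>open_frame X\<^esub> V = U \<inter> V"
proof -
  interpret complete_lattice "open_frame X" by (rule complete_lattice_open_frame)
  have "U \<sqinter>\<^bsub>open_frame X\<^esub> V \<subseteq> U" "U \<sqinter>\<^bsub>open_frame X\<^esub> V \<subseteq> V"
    using meet_left[of U V] meet_right[of U V] assms by auto
  moreover have "U \<inter> V \<subseteq> U \<sqinter>\<^bsub>open_frame X\<^esub> V"
    using meet_le[of "U \<inter> V" U V] assms by auto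
  ultimately show ?thesis by blast
qed

lemma top_open_frame: "\<top>\<^bsub>open_frame X\<^esub> = topspace X"
proof -
  interpret complete_lattice "open_frame X" by (rule complete_lattice_open_frame)
  show ?thesis
    using top_higher[of "topspace X"] top_closed openin_subset by auto
qed

lemma bottom_open_frame: "\<bottom>\<^bsub>open_frame X\<^esub> = {}"
proof -
  interpret complete_lattice "open_frame X" by (rule complete_lattice_open_frame)
  show ?thesis using bottom_lower[of "{}"] by auto
qed

lemma frame_lattice_open_frame: "frame_lattice (open_frame X)"
proof -
  interpret complete_lattice "open_frame X" by (rule complete_lattice_open_frame)
  show ?thesis
  proof
    fix U S assume U: "U \<in> carrier (open_frame X)" and S: "S \<subseteq> carrier (open_frame X)"
    have "(\<lambda>V. U \<sqinter>\<^bsub>open_frame X\<^esub> V) ` S = (\<lambda>V. U \<inter> V) ` S"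
      using U S by (intro image_cong) (auto simp: meet_open_frame)
    moreover have "(\<lambda>V. U \<inter> V) ` S \<subseteq> carrier (open_frame X)" using U S by auto
    moreover have "openin X (\<Union>S)" using S by auto
    ultimately show "U \<sqinter>\<^bsub>open_frame X\<^esub> (\<Squnion>\<^bsub>open_frame X\<^esub> S)
        = \<Squnion>\<^bsub>open_frame X\<^esub> ((\<lambda>V. U \<sqinter>\<^bsub>open_frame X\<^esub> V) ` S)"
      using U S by (simp add: sup_open_frame meet_open_frame)
  qed
qed

section \<open>Compact Hausdorff spaces yield objects of \<open>T1Frm_n\<close>\<close>

lemma T1_frame_open_frame:
  assumes "compact_space X" "Hausdorff_space X"
  shows "T1_frame (open_frame X)"
proof -
  let ?F = "open_frame X"
  interpret frame_lattice ?F by (rule frame_lattice_open_frame)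
  show ?thesis
  proof
    fix S assume S: "S \<subseteq> carrier ?F" "\<Squnion>\<^bsub>?F\<^esub> S = \<top>\<^bsub>?F\<^esub>"
    then have "(\<forall>U\<in>S. openin X U) \<and> \<Union>S = topspace X"
      by (auto simp: sup_open_frame top_open_frame)
    from assms(1)[unfolded compact_space, THEN spec, THEN mp, OF this]
    obtain T where T: "finite T" "T \<subseteq> S" "\<Union>T = topspace X" by auto
    then have "\<Squnion>\<^bsub>?F\<^esub> T = \<top>\<^bsub>?F\<^esub>"
      using S sup_open_frame[of T X] by (simp add: top_open_frame)
    then show "\<exists>S'. S' \<subseteq> S \<and> finite S' \<and> \<Squnion>\<^bsub>?F\<^esub> S' = \<top>\<^bsub>?F\<^esub>" using T by blast
  next
    show "conjunctive ?F"
      unfolding conjunctive_def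
    proof (intro ballI impI)
      fix U V assume U: "U \<in> carrier ?F" and V: "V \<in> carrier ?F"
        and UV: "\<forall>W\<in>carrier ?F. U \<squnion>\<^bsub>?F\<^esub> W = \<top>\<^bsub>?F\<^esub> \<longrightarrow> V \<squnion>\<^bsub>?F\<^esub> W = \<top>\<^bsub>?F\<^esub>"
      \<comment> \<open>Test the hypothesis at the complement of x, which is open because points are
        closed: U together with it covers the space, so V must supply x.\<close>
      have "x \<in> V" if x: "x \<in> U" for x
      proof -
        have xX: "x \<in> topspace X" using x U openin_subset by auto
        then have W: "openin X (topspace X - {x})"
          using assms(2) by (simp add: closedin_Hausdorff_sing_eq openin_diff)
        have "U \<union> (topspace X - {x}) = topspace X" using x U openin_subset by auto
        then have "V \<union> (topspace X - {x}) = topspace X"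
          using UV W U V by (simp add: join_open_frame top_open_frame)
        then show ?thesis using xX by blast
      qed
      then show "U \<sqsubseteq>\<^bsub>?F\<^esub> V" by auto
    qed
  next
    show "normal_lattice ?F"
      unfolding normal_lattice_def
    proof (intro ballI impI)
      fix U V assume U: "U \<in> carrier ?F" and V: "V \<in> carrier ?F" and "U \<squnion>\<^bsub>?F\<^esub> V = \<top>\<^bsub>?F\<^esub>"
      then have UV: "U \<union> V = topspace X" by (simp add: join_open_frame top_open_frame)
      \<comment> \<open>As U and V cover the space, their complements are disjoint closed sets. Open
        sets separating them serve as the two witnesses.\<close>
      have "closedin X (topspace X - U)" "closedin X (topspace X - V)"
        "disjnt (topspace X - U) (topspace X - V)"
        using U V UV by (auto simp: disjnt_def)
      moreover have "normal_space X"
        using assms compact_Hausdorff_or_regular_imp_normal_space by blast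
      ultimately obtain C D where CD: "openin X C" "openin X D" "topspace X - U \<subseteq> C"
          "topspace X - V \<subseteq> D" "disjnt C D"
        unfolding normal_space_def by meson
      then have "C \<union> U = topspace X" "V \<union> D = topspace X"
        using openin_subset[of X] U V by auto
      then show "\<exists>C\<in>carrier ?F. \<exists>D\<in>carrier ?F.
          C \<squnion>\<^bsub>?F\<^esub> U = \<top>\<^bsub>?F\<^esub> \<and> V \<squnion>\<^bsub>?F\<^esub> D = \<top>\<^bsub>?F\<^esub> \<and> C \<sqinter>\<^bsub>?F\<^esub> D = \<bottom>\<^bsub>?F\<^esub>"
        using CD U V
        by (intro bexI[of _ C] bexI[of _ D])
          (simp_all add: join_open_frame meet_open_frame top_open_frame bottom_open_frame disjnt_def)
    qed
  qed
qed

text \<open>A proper open set misses some point x and so lies inside the complement of x. This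
  complement is open because points are closed, and no open set lies strictly between it and the
  whole space.\<close>

lemma coatom_open_frame:
  assumes "Hausdorff_space X"
  shows "coatom (open_frame X) U \<longleftrightarrow> (\<exists>x\<in>topspace X. U = topspace X - {x})"
proof
  assume U: "coatom (open_frame X) U"
  then have Uo: "openin X U" "U \<noteq> topspace X" by (auto simp: coatom_def top_open_frame)
  then obtain x where x: "x \<in> topspace X" "x \<notin> U" using openin_subset by blast
  then have "openin X (topspace X - {x})"
    using assms by (simp add: closedin_Hausdorff_sing_eq openin_diff)
  moreover have "U \<subseteq> topspace X - {x}" using x openin_subset[OF Uo(1)] by blast
  moreover have "topspace X - {x} \<noteq> topspace X" using x by blast
  ultimately have "topspace X - {x} = U"
    using U unfolding coatom_def top_open_frame by simp
  then show "\<exists>x\<in>topspace X. U = topspace X - {x}" using x by blast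
next
  assume "\<exists>x\<in>topspace X. U = topspace X - {x}"
  then obtain x where x: "x \<in> topspace X" "U = topspace X - {x}" by blast
  then have "openin X U"
    using assms by (simp add: closedin_Hausdorff_sing_eq openin_diff)
  moreover have "V = U" if "openin X V" "V \<noteq> topspace X" "U \<subseteq> V" for V
    using that x openin_subset[OF that(1)] by blast
  ultimately show "coatom (open_frame X) U"
    using x unfolding coatom_def top_open_frame by auto
qed

section \<open>Unit and counit\<close>

text \<open>The component at X of the natural isomorphism from the identity to
  \<open>Max \<circ> D\<close>.\<close>

definition point_ideal :: "'a topology \<Rightarrow> 'a \<Rightarrow> 'a set set" where
  "point_ideal X x = {U. openin X U \<and> x \<notin> U}"

lemma point_ideal_eq:
  assumes "x \<in> topspace X"
  shows "point_ideal X x = principal_ideal (open_frame X) (topspace X - {x})"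
  using openin_subset by (auto simp: point_ideal_def principal_ideal_def)

lemma maximal_ideals_open_frame:
  assumes "compact_space X" "Hausdorff_space X"
  shows "maximal_ideals (open_frame X) = point_ideal X ` topspace X"
proof -
  interpret T1_frame "open_frame X" using assms by (rule T1_frame_open_frame)
  have "{m. coatom (open_frame X) m} = (\<lambda>x. topspace X - {x}) ` topspace X"
    using coatom_open_frame[OF assms(2)] by auto
  then show ?thesis
    by (simp add: maximal_ideals_eq image_image point_ideal_eq cong: image_cong)
qed

text \<open>The point x lies in U exactly when its ideal lies in the basic open of U, and basic
  opens are all the opens of the spectrum. So images and preimages under this bijection match open
  sets with open sets.\<close>

lemma homeomorphic_map_point_ideal:
  assumes X: "compact_space X" "Hausdorff_space X"
  shows "homeomorphic_map X (Max_space (open_frame X)) (point_ideal X)"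
proof -
  interpret T1_frame "open_frame X" using X by (rule T1_frame_open_frame)
  let ?M = "Max_space (open_frame X)"
  have top: "topspace ?M = point_ideal X ` topspace X"
    using topspace_Max_space maximal_ideals_open_frame[OF X] by simp
  have mem: "point_ideal X x \<in> basic_open (open_frame X) U \<longleftrightarrow> x \<in> U"
    if "x \<in> topspace X" "openin X U" for x U
    using that maximal_ideals_open_frame[OF X] by (auto simp: basic_open_def point_ideal_def)
  have preimage: "{x \<in> topspace X. point_ideal X x \<in> basic_open (open_frame X) U} = U"
    if "openin X U" for U
    using mem[OF _ that] openin_subset[OF that] by auto
  have image: "point_ideal X ` U = basic_open (open_frame X) U" if "openin X U" for U
  proof
    show "point_ideal X ` U \<subseteq> basic_open (open_frame X) U"
      using mem[OF _ that] openin_subset[OF that] by auto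
    show "basic_open (open_frame X) U \<subseteq> point_ideal X ` U"
      using basic_open_subset[of U] maximal_ideals_open_frame[OF X] mem[OF _ that] by auto
  qed
  show ?thesis
  proof (rule bijective_open_imp_homeomorphic_map)
    show "continuous_map X ?M (point_ideal X)"
      using preimage by (auto simp: continuous_map_def top openin_Max_space_iff)
    show "open_map X ?M (point_ideal X)"
      using image by (auto simp: open_map_def openin_Max_space_iff)
    show "point_ideal X ` topspace X = topspace ?M" using top by simp
    show "inj_on (point_ideal X) (topspace X)"
    proof (rule inj_onI)
      fix x y assume xy: "x \<in> topspace X" "y \<in> topspace X" "point_ideal X x = point_ideal X y"
      \<comment> \<open>This open set separates ideals: it belongs to the ideal of x, and to that of
        y only if y is x.\<close>
      have "openin X (topspace X - {x})"
        using X xy by (simp add: closedin_Hausdorff_sing_eq openin_diff)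
      then have "topspace X - {x} \<in> point_ideal X x" by (simp add: point_ideal_def)
      then have "topspace X - {x} \<in> point_ideal X y" using xy(3) by simp
      then show "x = y" using xy(2) by (auto simp: point_ideal_def)
    qed
  qed
qed

lemma (in T1_frame) frame_hom_basic_open:
  "frame_hom L (open_frame (Max_space L)) (basic_open L)"
  unfolding frame_hom_def
proof (intro conjI allI ballI impI)
  show "basic_open L \<in> carrier L \<rightarrow> carrier (open_frame (Max_space L))"
    using openin_Max_space_iff by auto
  show "basic_open L \<top> = \<top>\<^bsub>open_frame (Max_space L)\<^esub>"
    by (simp add: basic_open_top top_open_frame topspace_Max_space)
next
  fix S assume S: "S \<subseteq> carrier L"
  then have "basic_open L ` S \<subseteq> carrier (open_frame (Max_space L))"
    using openin_Max_space_iff by auto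
  then show "basic_open L (\<Squnion>S) = \<Squnion>\<^bsub>open_frame (Max_space L)\<^esub> (basic_open L ` S)"
    using S by (simp add: sup_open_frame basic_open_sup)
next
  fix a b assume ab: "a \<in> carrier L" "b \<in> carrier L"
  then have "openin (Max_space L) (basic_open L a)" "openin (Max_space L) (basic_open L b)"
    using openin_Max_space_iff by auto
  then show "basic_open L (a \<sqinter> b) = basic_open L a \<sqinter>\<^bsub>open_frame (Max_space L)\<^esub> basic_open L b"
    using ab by (simp add: basic_open_meet meet_open_frame)
qed

text \<open>Injectivity comes from conjunctivity, surjectivity from every open set of the spectrum
  being basic.\<close>

lemma (in T1_frame) frame_isos_basic_open:
  "frame_isos L (open_frame (Max_space L)) (basic_open L) (inv_into (carrier L) (basic_open L))"
proof (rule frame_isos_inv_into)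
  show "bij_betw (basic_open L) (carrier L) (carrier (open_frame (Max_space L)))"
    using basic_open_inj openin_Max_space_iff by (auto simp: bij_betw_def inj_on_def)
qed (simp_all add: frame_lattice_axioms frame_lattice_open_frame frame_hom_basic_open)

section \<open>Functoriality\<close>

lemma ob_CHaus: "X \<in> cat_ob CHaus \<longleftrightarrow> compact_space X \<and> Hausdorff_space X"
  and hom_CHaus: "f \<in> cat_hom CHaus X Y \<longleftrightarrow> f \<in> extensional (topspace X) \<and> continuous_map X Y f"
  and id_CHaus: "cat_id CHaus X = (\<lambda>x\<in>topspace X. x)"
  and comp_CHaus: "cat_comp CHaus X Y Z g f = compose (topspace X) g f"
  by (simp_all add: CHaus_def)

lemma hom_T1Frm_n: "h \<in> cat_hom T1Frm_n F G \<longleftrightarrow> h \<in> extensional (carrier F) \<and> frame_hom F G h"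
  and id_T1Frm_n: "cat_id T1Frm_n F = (\<lambda>a\<in>carrier F. a)"
  and comp_T1Frm_n: "cat_comp T1Frm_n F G H k h = compose (carrier F) k h"
  by (simp_all add: T1Frm_n_def)

lemma op_cat_simps:
  "cat_ob (op_cat C) = cat_ob C"
  "cat_hom (op_cat C) x y = cat_hom C y x"
  "cat_id (op_cat C) = cat_id C"
  "cat_comp (op_cat C) x y z g f = cat_comp C z y x f g"
  by (simp_all add: op_cat_def)

lemma compose_Id_ext: "f \<in> extensional A \<Longrightarrow> compose A f (\<lambda>x\<in>A. x) = f"
  by (auto simp: compose_def extensional_def)

lemma is_category_CHaus: "is_category CHaus"
proof -
  have comp: "continuous_map X Z (compose (topspace X) g f)"
    if "continuous_map X Y f" "continuous_map Y Z g" for X Y Z :: "'a topology" and f g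
    using continuous_map_compose[OF that]
    by (rule continuous_map_eq) (simp add: compose_def)
  have id: "continuous_map X X (\<lambda>x\<in>topspace X. x)" for X :: "'a topology"
    by (rule continuous_map_eq[OF continuous_map_id]) simp
  \<comment> \<open>The inner \<open>compose (topspace X) h g\<close> is meaningful only on
    \<open>topspace X\<close>, so the law needs f to map into that set.\<close>
  have assoc: "compose (topspace W) (compose (topspace X) h g) f
      = compose (topspace W) h (compose (topspace W) g f)"
    if "continuous_map W X f" for W X :: "'a topology" and f g h
    using that by (auto simp: compose_def continuous_map_def fun_eq_iff Pi_iff)
  have unit: "compose (topspace X) (\<lambda>y\<in>topspace Y. y) f = f"
    if "f \<in> extensional (topspace X)" "continuous_map X Y f" for X Y :: "'a topology" and f
    using that by (intro Id_compose) (simp_all add: continuous_map_def)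
  show ?thesis
    unfolding is_category_def
    by (intro conjI ballI)
      (auto simp: hom_CHaus id_CHaus comp_CHaus id assoc unit compose_Id_ext intro: comp)
qed

lemma is_category_T1Frm_n: "is_category T1Frm_n"
proof -
  have comp: "frame_hom F H (compose (carrier F) k h)"
    if "T1_frame F" "frame_hom F G h" "frame_hom G H k" for F G H :: "'a gorder" and h k
    by (rule frame_hom_cong[OF _ frame_hom_compose[OF that(2,3)]])
      (use that(1) in \<open>simp_all add: compose_def T1_frame_def compact_frame_lattice_def\<close>)
  have id: "frame_hom F F (\<lambda>a\<in>carrier F. a)" if "T1_frame F" for F :: "'a gorder"
    by (rule frame_hom_cong[OF _ frame_hom_id])
      (use that in \<open>simp_all add: T1_frame_def compact_frame_lattice_def\<close>)
  have assoc: "compose (carrier E) (compose (carrier F) k h) g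
      = compose (carrier E) k (compose (carrier E) h g)"
    if "frame_hom E F g" for E F :: "'a gorder" and g h k
    using frame_hom_closed[OF that] by (auto simp: compose_def fun_eq_iff)
  have unit: "compose (carrier F) (\<lambda>b\<in>carrier G. b) h = h"
    if "h \<in> extensional (carrier F)" "frame_hom F G h" for F G :: "'a gorder" and h
    using that by (intro Id_compose) (simp_all add: frame_hom_def)
  show ?thesis
    unfolding is_category_def
    by (intro conjI ballI)
      (auto simp: ob_T1Frm_n hom_T1Frm_n id_T1Frm_n comp_T1Frm_n id assoc unit compose_Id_ext
        intro: comp)
qed

section \<open>The functors D and Max on morphisms\<close>

lemma D_functor_simps:
  "fun_ob D_functor X = open_frame X"
  "fun_map D_functor X Y f = (\<lambda>U\<in>carrier (open_frame X). {y \<in> topspace Y. f y \<in> U})"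
  by (simp_all add: D_functor_def)

lemma Max_functor_simps:
  "fun_ob Max_functor F = Max_space F"
  "fun_map Max_functor F G h = (\<lambda>M\<in>topspace (Max_space G). {a \<in> carrier F. h a \<in> M})"
  by (simp_all add: Max_functor_def)

lemma frame_hom_preimage:
  assumes f: "continuous_map Y X f"
  shows "frame_hom (open_frame X) (open_frame Y) (\<lambda>U\<in>carrier (open_frame X). {y \<in> topspace Y. f y \<in> U})"
proof (rule frame_hom_cong[OF frame_lattice_open_frame])
  let ?h = "\<lambda>U. {y \<in> topspace Y. f y \<in> U}"
  have op: "openin Y (?h U)" if "openin X U" for U
    using f that by (simp add: continuous_map_def)
  show "frame_hom (open_frame X) (open_frame Y) ?h"
    unfolding frame_hom_def
  proof (intro conjI allI ballI impI)
    show "?h \<in> carrier (open_frame X) \<rightarrow> carrier (open_frame Y)" using op by simp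
    show "?h \<top>\<^bsub>open_frame X\<^esub> = \<top>\<^bsub>open_frame Y\<^esub>"
      using f by (auto simp: top_open_frame continuous_map_def)
  next
    fix S assume S: "S \<subseteq> carrier (open_frame X)"
    then have "?h ` S \<subseteq> carrier (open_frame Y)" using op by auto
    then show "?h (\<Squnion>\<^bsub>open_frame X\<^esub> S) = \<Squnion>\<^bsub>open_frame Y\<^esub> (?h ` S)"
      unfolding sup_open_frame[OF S] by (subst sup_open_frame) auto
  next
    fix U V assume UV: "U \<in> carrier (open_frame X)" "V \<in> carrier (open_frame X)"
    then show "?h (U \<sqinter>\<^bsub>open_frame X\<^esub> V) = ?h U \<sqinter>\<^bsub>open_frame Y\<^esub> ?h V"
      using op[of U] op[of V] by (auto simp: meet_open_frame)
  qed
qed simp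

lemma is_functor_D: "is_functor (op_cat CHaus) T1Frm_n D_functor"
  unfolding is_functor_def op_cat_simps D_functor_simps
proof (intro conjI ballI)
  fix X :: "'a topology" assume "X \<in> cat_ob CHaus"
  then show "open_frame X \<in> cat_ob T1Frm_n"
    by (simp add: ob_CHaus ob_T1Frm_n T1_frame_open_frame)
  show "(\<lambda>U\<in>carrier (open_frame X). {y \<in> topspace X. cat_id CHaus X y \<in> U})
      = cat_id T1Frm_n (open_frame X)"
    unfolding id_CHaus id_T1Frm_n
    by (rule restrict_ext) (use openin_subset in fastforce)
next
  fix X Y :: "'a topology" and f
  assume "f \<in> cat_hom CHaus Y X"
  then show "(\<lambda>U\<in>carrier (open_frame X). {y \<in> topspace Y. f y \<in> U})
      \<in> cat_hom T1Frm_n (open_frame X) (open_frame Y)"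
    using frame_hom_preimage[of Y X f] by (simp add: hom_CHaus hom_T1Frm_n)
next
  fix X Y Z :: "'a topology" and f g
  assume "f \<in> cat_hom CHaus Y X" "g \<in> cat_hom CHaus Z Y"
  then have f: "continuous_map Y X f" and g: "continuous_map Z Y g" by (simp_all add: hom_CHaus)
  have "{z \<in> topspace Z. compose (topspace Z) f g z \<in> U}
      = {z \<in> topspace Z. g z \<in> {y \<in> topspace Y. f y \<in> U}}" for U
    using g by (auto simp: compose_def continuous_map_def)
  \<comment> \<open>The second restricted preimage map evaluates correctly only on open sets of Y,
    so the first preimage must be known to be open.\<close>
  moreover have "openin Y {y \<in> topspace Y. f y \<in> U}" if "openin X U" for U
    using f that by (simp add: continuous_map_def)
  ultimately show "(\<lambda>U\<in>carrier (open_frame X). {z \<in> topspace Z. cat_comp CHaus Z Y X f g z \<in> U})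
      = cat_comp T1Frm_n (open_frame X) (open_frame Y) (open_frame Z)
          (\<lambda>V\<in>carrier (open_frame Y). {z \<in> topspace Z. g z \<in> V})
          (\<lambda>U\<in>carrier (open_frame X). {y \<in> topspace Y. f y \<in> U})"
    unfolding comp_CHaus comp_T1Frm_n by (auto simp: compose_def fun_eq_iff)
qed

text \<open>Pulling back ideals along h sends maximal ideals to maximal ideals, and the preimage of
  the basic open of a is the basic open of \<open>h a\<close>.\<close>

lemma continuous_map_Max_space:
  assumes F: "T1_frame F" and G: "T1_frame G" and h: "frame_hom F G h"
  shows "continuous_map (Max_space G) (Max_space F)
    (\<lambda>M\<in>topspace (Max_space G). {a \<in> carrier F. h a \<in> M})"
proof -
  interpret F: T1_frame F by fact
  interpret G: T1_frame G by fact
  let ?p = "\<lambda>M\<in>topspace (Max_space G). {a \<in> carrier F. h a \<in> M}"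
  have mem: "?p M \<in> maximal_ideals F" if "M \<in> maximal_ideals G" for M
    using pullback_maximal_ideal[OF F G.compact_frame_lattice_axioms h that] that
    by (simp add: G.topspace_Max_space)
  have preimage: "{M \<in> topspace (Max_space G). ?p M \<in> basic_open F a} = basic_open G (h a)"
    if "a \<in> carrier F" for a
    using mem that by (auto simp: basic_open_def G.topspace_Max_space)
  show ?thesis
    unfolding continuous_map_def
  proof (intro conjI allI impI)
    show "?p \<in> topspace (Max_space G) \<rightarrow> topspace (Max_space F)"
      using mem by (simp add: F.topspace_Max_space G.topspace_Max_space)
    fix U assume "openin (Max_space F) U"
    then obtain a where "a \<in> carrier F" "U = basic_open F a"
      by (auto simp: F.openin_Max_space_iff)
    then show "openin (Max_space G) {M \<in> topspace (Max_space G). ?p M \<in> U}"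
      using preimage frame_hom_closed[OF h] by (auto simp: G.openin_Max_space_iff)
  qed
qed

lemma is_functor_Max: "is_functor T1Frm_n (op_cat CHaus) Max_functor"
  unfolding is_functor_def op_cat_simps Max_functor_simps
proof (intro conjI ballI)
  fix F :: "'b gorder" assume "F \<in> cat_ob T1Frm_n"
  then interpret T1_frame F by (simp add: ob_T1Frm_n)
  show "Max_space F \<in> cat_ob CHaus"
    using compact_Max_space Hausdorff_Max_space normal by (simp add: ob_CHaus)
  show "(\<lambda>M\<in>topspace (Max_space F). {a \<in> carrier F. cat_id T1Frm_n F a \<in> M})
      = cat_id CHaus (Max_space F)"
    unfolding id_CHaus id_T1Frm_n topspace_Max_space
    by (rule restrict_ext) (auto simp: maximal_ideals_def lattice_ideal_def)
next
  fix F G :: "'b gorder" and h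
  assume "F \<in> cat_ob T1Frm_n" "G \<in> cat_ob T1Frm_n" "h \<in> cat_hom T1Frm_n F G"
  then show "(\<lambda>M\<in>topspace (Max_space G). {a \<in> carrier F. h a \<in> M})
      \<in> cat_hom CHaus (Max_space G) (Max_space F)"
    using continuous_map_Max_space[of F G h] by (simp add: ob_T1Frm_n hom_T1Frm_n hom_CHaus)
next
  fix F G H :: "'b gorder" and h k
  assume ob: "F \<in> cat_ob T1Frm_n" "G \<in> cat_ob T1Frm_n" "H \<in> cat_ob T1Frm_n"
    and hom: "h \<in> cat_hom T1Frm_n F G" "k \<in> cat_hom T1Frm_n G H"
  let ?p = "\<lambda>M\<in>topspace (Max_space H). {b \<in> carrier G. k b \<in> M}"
  \<comment> \<open>The pullback along k must be a maximal ideal of G, since the pullback along h is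
    restricted to those.\<close>
  have "?p M \<in> topspace (Max_space G)" if "M \<in> topspace (Max_space H)" for M
    using continuous_map_Max_space[of G H k] ob hom that
    by (simp add: ob_T1Frm_n hom_T1Frm_n continuous_map_def Pi_iff)
  moreover have "h a \<in> carrier G" if "a \<in> carrier F" for a
    using hom(1) that frame_hom_closed[of F G h a] by (simp add: hom_T1Frm_n)
  ultimately show "(\<lambda>M\<in>topspace (Max_space H). {a \<in> carrier F. cat_comp T1Frm_n F G H k h a \<in> M})
      = cat_comp CHaus (Max_space H) (Max_space G) (Max_space F)
          (\<lambda>M\<in>topspace (Max_space G). {a \<in> carrier F. h a \<in> M}) ?p"
    unfolding comp_CHaus comp_T1Frm_n by (auto simp: compose_def fun_eq_iff)
qed

section \<open>Natural isomorphisms with the identity functors\<close>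

lemma fun_comp_simps:
  "fun_ob (fun_comp S T) x = fun_ob S (fun_ob T x)"
  "fun_map (fun_comp S T) x y f = fun_map S (fun_ob T x) (fun_ob T y) (fun_map T x y f)"
  by (simp_all add: fun_comp_def)

lemma op_fun_simps:
  "fun_ob (op_fun T) x = fun_ob T x"
  "fun_map (op_fun T) x y f = fun_map T y x f"
  by (simp_all add: op_fun_def)

text \<open>The composite is defined on \<open>op_cat CHaus\<close>, and \<open>op_fun\<close> turns
  it back into an endofunctor-like map on \<open>CHaus\<close>. Naturality says that the preimage of
  U under f omits x exactly when U omits \<open>f x\<close>.\<close>

lemma CHaus_id_iso_Max_D:
  "CHaus_id_iso (op_fun (fun_comp Max_functor
     (D_functor :: ('a topology, 'a \<Rightarrow> 'a, 'a set gorder, 'a set \<Rightarrow> 'a set) functor_data)))"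
  unfolding CHaus_id_iso_def op_fun_simps fun_comp_simps D_functor_simps Max_functor_simps
proof (intro exI[of _ point_ideal] conjI ballI)
  fix X :: "'a topology" assume "X \<in> cat_ob CHaus"
  then show "\<exists>\<zeta>. homeomorphic_maps X (Max_space (open_frame X)) (point_ideal X) \<zeta>"
    using homeomorphic_map_point_ideal[of X] by (simp add: ob_CHaus homeomorphic_map_maps)
next
  fix X Y :: "'a topology" and f x
  assume XY: "X \<in> cat_ob CHaus" "Y \<in> cat_ob CHaus" and "f \<in> cat_hom CHaus X Y"
    and x: "x \<in> topspace X"
  then have f: "continuous_map X Y f" by (simp add: hom_CHaus)
  have X: "compact_space X" "Hausdorff_space X" using XY by (simp_all add: ob_CHaus)
  interpret T1_frame "open_frame X" using X by (rule T1_frame_open_frame)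
  have "point_ideal X x \<in> topspace (Max_space (open_frame X))"
    using x maximal_ideals_open_frame[OF X] by (simp add: topspace_Max_space)
  then show "(\<lambda>M\<in>topspace (Max_space (open_frame X)). {U \<in> carrier (open_frame Y).
        (\<lambda>U\<in>carrier (open_frame Y). {x \<in> topspace X. f x \<in> U}) U \<in> M}) (point_ideal X x)
      = point_ideal Y (f x)"
    using x f by (auto simp: point_ideal_def continuous_map_def)
qed

text \<open>Naturality holds because the pullback of M along h omits a exactly when M omits
  \<open>h a\<close>; that this pullback is again maximal is
  \<open>pullback_maximal_ideal\<close>.\<close>

lemma T1Frm_n_id_iso_D_Max:
  "T1Frm_n_id_iso (fun_comp D_functor
     (Max_functor :: ('b gorder, 'b \<Rightarrow> 'b, 'b set topology, 'b set \<Rightarrow> 'b set) functor_data))"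
  unfolding T1Frm_n_id_iso_def fun_comp_simps D_functor_simps Max_functor_simps
proof (intro exI[of _ basic_open] conjI ballI)
  fix F :: "'b gorder" assume "F \<in> cat_ob T1Frm_n"
  then show "\<exists>\<delta>. frame_isos F (open_frame (Max_space F)) (basic_open F) \<delta>"
    using T1_frame.frame_isos_basic_open[of F] by (auto simp: ob_T1Frm_n)
next
  fix F G :: "'b gorder" and h a
  assume FG: "F \<in> cat_ob T1Frm_n" "G \<in> cat_ob T1Frm_n" and "h \<in> cat_hom T1Frm_n F G"
    and a: "a \<in> carrier F"
  then have h: "frame_hom F G h" by (simp add: hom_T1Frm_n)
  interpret F: T1_frame F using FG by (simp add: ob_T1Frm_n)
  interpret G: T1_frame G using FG by (simp add: ob_T1Frm_n)
  have "basic_open F a \<in> carrier (open_frame (Max_space F))"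
    using a F.openin_Max_space_iff by auto
  then show "(\<lambda>U\<in>carrier (open_frame (Max_space F)). {M \<in> topspace (Max_space G).
        (\<lambda>M\<in>topspace (Max_space G). {a \<in> carrier F. h a \<in> M}) M \<in> U}) (basic_open F a)
      = basic_open G (h a)"
    using a pullback_maximal_ideal[OF F.T1_frame_axioms G.compact_frame_lattice_axioms h]
    by (auto simp: G.topspace_Max_space basic_open_def)
qed

theorem theorem3p10:
  shows "is_category (CHaus :: ('a topology, 'a \<Rightarrow> 'a) category) \<and>
    is_category (T1Frm_n :: ('b gorder, 'b \<Rightarrow> 'b) category) \<and>
    (\<forall>F :: 'b gorder. compact_frame F \<and> normal_lattice F \<longrightarrow> (conjunctive F \<longleftrightarrow> coatomistic F)) \<and>
    is_functor (op_cat (CHaus :: ('a topology, 'a \<Rightarrow> 'a) category)) T1Frm_n D_functor \<and>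
    is_functor (T1Frm_n :: ('b gorder, 'b \<Rightarrow> 'b) category) (op_cat CHaus) Max_functor \<and>
    CHaus_id_iso (op_fun (fun_comp Max_functor
      (D_functor :: ('a topology, 'a \<Rightarrow> 'a, 'a set gorder, 'a set \<Rightarrow> 'a set) functor_data))) \<and>
    T1Frm_n_id_iso (fun_comp D_functor
      (Max_functor :: ('b gorder, 'b \<Rightarrow> 'b, 'b set topology, 'b set \<Rightarrow> 'b set) functor_data))"
  by (intro conjI allI impI is_category_CHaus is_category_T1Frm_n is_functor_D is_functor_Max
      CHaus_id_iso_Max_D T1Frm_n_id_iso_D_Max)
    (simp add: compact_frame_iff_locale compact_frame_lattice.conjunctive_iff_coatomistic)

end
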